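(* Let $(S^k)_{k\ge0}$ be a sequence generated by the accelerated geometric DC algorithm (described in the context), with step-size sequences $(\theta_k)_{k\ge0},(h_k)_{k\ge0}$ that additionally satisfy: $\theta_k\in[\theta_{\min},\theta_{\max}]$ for all $k$, the limit $\lim_{k\to\infty}\theta_k$ exists and is positive, and $\sum_{k\ge0}h_k<\infty$. If there exists an index $K\in\mathbb N$ such that for all $k\ge K$ $$h_k\le C(\Omega)\,\frac{\|\mathrm{grad}_gJ(S^k)\|^2_{S^k}}{n},\qquad C(\Omega):=2\,\frac{\theta_{\min}c_1}{\lambda^2(\Omega)},\qquad\lambda(\Omega)=\max\{|\lambda_{\min}(\Omega)|,|\lambda_{\max}(\Omega)|\},$$ then the set of limit points $$\Lambda=\{S\in\overline{\mathcal W}:\exists\,(S^{k_l})_{l\ge0}\text{ with }S^{k_l}\to S\text{ for }l\to\infty\}$$ is a singleton $\Lambda=\{S^*\}$ and $\lim_{k\to\infty}D_{\mathrm{KL}}(S^*,S^k)=0$ holds, i.e. the sequence $(S^k)_{k\ge0}$ converges to a unique $S^*\in\overline{\mathcal W}$, which is an equilibrium of the flow $\dot S=R_S(\Omega S)$.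
   Context: $\mathcal V\subset\mathbb Z^d$ ($d\ge2$) is a finite vertex set, $n=|\mathcal V|$, and $c\ge2$ is the number of labels. $\Omega\in\mathbb R^{\mathcal V\times\mathcal V}$ is of the form $\Omega(x,y)=\Theta(x,y)\alpha^2(x,y)$ for $x\ne y$, $\Omega(x,x)=\Theta(x,x)$, where, with $\mathcal V^{\alpha}_{\mathcal I}=\{x\in\mathbb Z^d\setminus\mathcal V:\alpha(x,y)\neq0\text{ for some }y\in\mathcal V\}$ and $\overline{\mathcal V}=\mathcal V\,\dot\cup\,\mathcal V^{\alpha}_{\mathcal I}$ (finite), $\alpha\colon\overline{\mathcal V}\times\overline{\mathcal V}\to\mathbb R$ is antisymmetric with $\alpha=0$ on $\mathcal V^{\alpha}_{\mathcal I}\times\mathcal V^{\alpha}_{\mathcal I}$ and $\Theta\colon\overline{\mathcal V}\times\overline{\mathcal V}\to\mathbb R$ is symmetric and nonnegative. Standing assumption on the weights: $0\le\Omega(x,y)\le1$ and $\sum_{y\in\mathcal V}\Omega(x,y)=1$ for all $x\in\mathcal V$. $\lambda_{\min}(\Omega),\lambda_{\max}(\Omega)$ are the smallest and largest eigenvalues of $\Omega$. $\mathcal S$ is the relative interior of the probability simplex $\Delta_c\subset\mathbb R^c$; $\mathcal W$ is the set of $n\times c$ matrices $S$ with rows $S(x)\in\mathcal S$, $x\in\mathcal V$; $\overline{\mathcal W}$ its closure. $\mathcal T_0$ is the space of $n\times c$ matrices with all row sums zero, $\Pi_0$ the orthogonal projection onto it (row-wise). $R_p=\mathrm{Diag}(p)-pp^\top$,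 applied row-wise: $(R_SV)(x)=R_{S(x)}V(x)$. $\exp_p(v)=\frac{p\odot e^v}{\langle p,e^v\rangle}$ (componentwise operations, $v\in\mathbb R^c$), applied row-wise. $\Omega S$ is the matrix product; $\langle\cdot,\cdot\rangle$ is the Frobenius inner product. $\langle U,V\rangle_S=\sum_{x\in\mathcal V}\sum_{j=1}^c\frac{U_j(x)V_j(x)}{S_j(x)}$ and $\|U\|_S^2=\langle U,U\rangle_S$. $J(S)=-\frac12\langle S,\Omega S\rangle$, $\mathrm{grad}_gJ(S)=-R_S(\Omega S)$. $S^*\in\overline{\mathcal W}$ is an equilibrium if $R_{S^*}(\Omega S^* )=0$. $D_{\mathrm{KL}}(S,P)=\sum_{x\in\mathcal V}\sum_{j=1}^cS_j(x)\log\frac{S_j(x)}{P_j(x)}$ for $S\in\overline{\mathcal W}$, $P\in\mathcal W$ (with $0\log0=0$). Accelerated geometric DC algorithm (Algorithm 4 of the paper, run without termination): fix $0<c_1<c_2<1$, $\gamma>|\lambda_{\min}(\Omega)|>0$, $\theta_0=1/\gamma$ and the initial point $S^0=\exp_{\mathbb 1_{\mathcal W}}(-\Omega D_{\mathcal X})\in\mathcal W$, where $D_{\mathcal X}\in\mathbb R^{n\times c}$ is a data matrix and $\mathbb 1_{\mathcal W}$ has all entries $1/c$. At step $k$ choose $$h_k\in\Big(0,\frac{\|R_{S^k}(\Omega S^k)\|_{S^k}^2}{|\langle R_{S^k}(\Omega S^k),\Omega R_{S^k}(\Omega S^k)\rangle|}\Big),\qquad d^k=\Pi_0\Omega S^k+\frac{h_k}{2}\Omega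 R_{S^k}(\Omega S^k),$$ and set $S^{k+1}=\exp_{S^k}(\theta_kd^k)$, where $\theta_k$ is the current step size if it satisfies the two conditions below, and otherwise is determined by a bisection line search, with values in $[\theta_0,1/|\lambda_{\min}(\Omega)|]$, so that they are satisfied: $$J(S^{k+1})-J(S^k)\le c_1\theta_k\langle\mathrm{grad}_gJ(S^k),R_{S^k}(d^k)\rangle_{S^k},\quad |\langle\mathrm{grad}_gJ(S^{k+1}),R_{S^k}(d^k)\rangle_{S^k}|\le c_2|\langle\mathrm{grad}_gJ(S^k),R_{S^k}(d^k)\rangle_{S^k}| .$$ *)

theory Defs
  imports "HOL-Analysis.Analysis"
begin

text \<open>
  The finite vertex set \<open>V \<subseteq> \<int>\<^sup>d\<close> is enumerated by a finite type \<open>'v\<close> through a bijection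
  \<open>vert\<close> from \<open>'v\<close> onto \<open>V\<close>, so \<open>n = CARD('v)\<close>, and the labels are the elements of a finite
  type \<open>'c\<close>.  An \<open>n \<times> c\<close> matrix is an element of \<^typ>\<open>real^'c^'v\<close>: its row at \<open>x\<close> is
  \<open>S $ x\<close>, its inner product \<open>\<bullet>\<close> is the Frobenius inner product and its topology the Euclidean one.
\<close>

section \<open>Weights\<close>

definition interaction_vertices ::
    "((int^'d) \<Rightarrow> (int^'d) \<Rightarrow> real) \<Rightarrow> (int^'d) set \<Rightarrow> (int^'d) set" where
  "interaction_vertices \<alpha> V = {x. x \<notin> V \<and> (\<exists>y\<in>V. \<alpha> x y \<noteq> 0)}"

text \<open>\<open>\<alpha>\<close> and \<open>\<Theta>\<close> are total functions on \<open>\<int>\<^sup>d \<times> \<int>\<^sup>d\<close>; they are constrained only on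
  \<open>V \<union> V\<^sub>I\<close>, the set on which the mathematical objects live.\<close>

definition nonlocal_kernels ::
    "(int^'d) set \<Rightarrow> ((int^'d) \<Rightarrow> (int^'d) \<Rightarrow> real) \<Rightarrow> ((int^'d) \<Rightarrow> (int^'d) \<Rightarrow> real) \<Rightarrow> bool" where
  "nonlocal_kernels V \<alpha> \<Theta> \<longleftrightarrow>
     (let V\<^sub>I = interaction_vertices \<alpha> V; Vbar = V \<union> V\<^sub>I in
       finite Vbar \<and>
       (\<forall>x\<in>Vbar. \<forall>y\<in>Vbar. \<alpha> x y = - \<alpha> y x) \<and>
       (\<forall>x\<in>V\<^sub>I. \<forall>y\<in>V\<^sub>I. \<alpha> x y = 0) \<and>
       (\<forall>x\<in>Vbar. \<forall>y\<in>Vbar. \<Theta> x y = \<Theta> y x) \<and>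
       (\<forall>x\<in>Vbar. \<forall>y\<in>Vbar. 0 \<le> \<Theta> x y))"

definition weight_matrix ::
    "('v::finite \<Rightarrow> int^'d) \<Rightarrow> ((int^'d) \<Rightarrow> (int^'d) \<Rightarrow> real) \<Rightarrow> ((int^'d) \<Rightarrow> (int^'d) \<Rightarrow> real)
       \<Rightarrow> real^'v^'v" where
  "weight_matrix vert \<alpha> \<Theta> =
     (\<chi> x y. if x = y then \<Theta> (vert x) (vert x)
            else \<Theta> (vert x) (vert y) * (\<alpha> (vert x) (vert y))\<^sup>2)"

definition eigenvalues :: "real^'n^'n \<Rightarrow> real set" where
  "eigenvalues A = {l. \<exists>v. v \<noteq> 0 \<and> A *v v = l *\<^sub>R v}"

text \<open>Used for symmetric matrices only, whose set of real eigenvalues is finite and nonempty.\<close>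

definition lambda_min :: "real^'n^'n \<Rightarrow> real" where
  "lambda_min A = Min (eigenvalues A)"

definition lambda_max :: "real^'n^'n \<Rightarrow> real" where
  "lambda_max A = Max (eigenvalues A)"

definition lambda_abs :: "real^'n^'n \<Rightarrow> real" where
  "lambda_abs A = max \<bar>lambda_min A\<bar> \<bar>lambda_max A\<bar>"

section \<open>Assignment manifold\<close>

definition prob_simplex :: "(real^'c) set" where
  "prob_simplex = {p. (\<forall>j. 0 \<le> p $ j) \<and> (\<Sum>j\<in>UNIV. p $ j) = 1}"

definition assignment_manifold :: "(real^'c^'v) set" where
  "assignment_manifold = {S. \<forall>x. S $ x \<in> rel_interior prob_simplex}"

definition tangent_space :: "(real^'c^'v) set" where
  "tangent_space = {U. \<forall>x. (\<Sum>j\<in>UNIV. U $ x $ j) = 0}"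

definition proj_tangent :: "real^'c^'v \<Rightarrow> real^'c^'v" where
  "proj_tangent M = (THE P. P \<in> tangent_space \<and> (\<forall>U\<in>tangent_space. orthogonal (M - P) U))"

lemma proj_tangent_eq:
  fixes M :: "real^'c^'v"
  shows "proj_tangent M = (\<chi> x j. M $ x $ j - (\<Sum>i\<in>UNIV. M $ x $ i) / real CARD('c))"
    (is "_ = ?P")
proof -
  have P: "?P \<in> tangent_space"
    by (simp add: tangent_space_def sum_subtractf)
  have orth: "orthogonal (M - ?P) U" if "U \<in> tangent_space" for U
  proof -
    have "(\<Sum>j\<in>UNIV. (\<Sum>i\<in>UNIV. M $ x $ i) / real CARD('c) * U $ x $ j) = 0" for x
      using that unfolding tangent_space_def sum_distrib_left[symmetric] by simp
    then show ?thesis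
      by (simp add: orthogonal_def inner_vec_def)
  qed
  show ?thesis
    unfolding proj_tangent_def
  proof (rule the_equality)
    show "?P \<in> tangent_space \<and> (\<forall>U\<in>tangent_space. orthogonal (M - ?P) U)"
      using P orth by blast
  next
    fix Q assume Q: "Q \<in> tangent_space \<and> (\<forall>U\<in>tangent_space. orthogonal (M - Q) U)"
    have mem: "?P - Q \<in> tangent_space"
      using P Q by (simp add: tangent_space_def sum_subtractf)
    have "(M - Q) \<bullet> (?P - Q) = 0" "(M - ?P) \<bullet> (?P - Q) = 0"
      using Q orth mem by (auto simp: orthogonal_def)
    then have "(?P - Q) \<bullet> (?P - Q) = 0"
      by (simp add: inner_diff_left)
    then show "Q = ?P"
      by simp
  qed
qed

definition replicator_matrix :: "real^'c \<Rightarrow> real^'c^'c" where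
  "replicator_matrix p = (\<chi> i j. (if i = j then p $ i else 0) - p $ i * p $ j)"

definition replicator :: "real^'c^'v \<Rightarrow> real^'c^'v \<Rightarrow> real^'c^'v" where
  "replicator S U = (\<chi> x. replicator_matrix (S $ x) *v (U $ x))"

definition lift_exp :: "real^'c \<Rightarrow> real^'c \<Rightarrow> real^'c" where
  "lift_exp p v = (\<chi> j. p $ j * exp (v $ j) / (\<Sum>i\<in>UNIV. p $ i * exp (v $ i)))"

definition lift_exp_rows :: "real^'c^'v \<Rightarrow> real^'c^'v \<Rightarrow> real^'c^'v" where
  "lift_exp_rows S U = (\<chi> x. lift_exp (S $ x) (U $ x))"

definition barycenter :: "real^'c^'v" where
  "barycenter = (\<chi> x j. 1 / real CARD('c))"

definition metric :: "real^'c^'v \<Rightarrow> real^'c^'v \<Rightarrow> real^'c^'v \<Rightarrow> real" where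
  "metric S U V = (\<Sum>x\<in>UNIV. \<Sum>j\<in>UNIV. U $ x $ j * V $ x $ j / S $ x $ j)"

definition metric_norm_sq :: "real^'c^'v \<Rightarrow> real^'c^'v \<Rightarrow> real" where
  "metric_norm_sq S U = metric S U U"

definition objective :: "real^'v^'v \<Rightarrow> real^'c^'v \<Rightarrow> real" where
  "objective \<Omega> S = - (1/2) * (S \<bullet> (\<Omega> ** S))"

definition grad_objective :: "real^'v^'v \<Rightarrow> real^'c^'v \<Rightarrow> real^'c^'v" where
  "grad_objective \<Omega> S = - replicator S (\<Omega> ** S)"

definition equilibrium :: "real^'v^'v \<Rightarrow> real^'c^'v \<Rightarrow> bool" where
  "equilibrium \<Omega> S \<longleftrightarrow> S \<in> closure assignment_manifold \<and> replicator S (\<Omega> ** S) = 0"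

text \<open>The convention \<open>0 log 0 = 0\<close> is provided by the factor \<open>S $ x $ j = 0\<close>.\<close>

definition KL_divergence :: "real^'c^'v \<Rightarrow> real^'c^'v \<Rightarrow> real" where
  "KL_divergence S P = (\<Sum>x\<in>UNIV. \<Sum>j\<in>UNIV. S $ x $ j * ln (S $ x $ j / P $ x $ j))"

section \<open>Accelerated geometric DC algorithm\<close>

text \<open>
  The interval of admissible \<open>h\<close> is \<open>(0, \<parallel>G\<parallel>\<^sup>2 / \<bar>\<langle>G, \<Omega> G\<rangle>\<bar>)\<close> with \<open>G = R\<^sub>S (\<Omega> S)\<close>.  A vanishing
  denominator with \<open>G \<noteq> 0\<close> means that there is no upper bound (and not \<open>x / 0 = 0\<close>).  At an
  equilibrium, \<open>G = 0\<close>, the bound is \<open>0 / 0\<close> and the step does not move \<open>S\<close> for any choice of \<open>h\<close>;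
  only \<open>0 \<le> h\<close> is required there, so that runs arriving at an equilibrium are not excluded.
\<close>

definition admissible_h :: "real^'v^'v \<Rightarrow> real^'c^'v \<Rightarrow> real \<Rightarrow> bool" where
  "admissible_h \<Omega> S h \<longleftrightarrow>
     (let G = replicator S (\<Omega> ** S) in
       if G = 0 then 0 \<le> h
       else 0 < h \<and>
         (G \<bullet> (\<Omega> ** G) \<noteq> 0 \<longrightarrow> h < metric_norm_sq S G / \<bar>G \<bullet> (\<Omega> ** G)\<bar>))"

definition descent_direction :: "real^'v^'v \<Rightarrow> real^'c^'v \<Rightarrow> real \<Rightarrow> real^'c^'v" where
  "descent_direction \<Omega> S h =
     proj_tangent (\<Omega> ** S) + (h / 2) *\<^sub>R (\<Omega> ** replicator S (\<Omega> ** S))"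

definition line_search_conditions ::
    "real^'v^'v \<Rightarrow> real \<Rightarrow> real \<Rightarrow> real^'c^'v \<Rightarrow> real^'c^'v \<Rightarrow> real \<Rightarrow> bool" where
  "line_search_conditions \<Omega> c1 c2 S d \<theta> \<longleftrightarrow>
     (let S' = lift_exp_rows S (\<theta> *\<^sub>R d) in
       objective \<Omega> S' - objective \<Omega> S
         \<le> c1 * \<theta> * metric S (grad_objective \<Omega> S) (replicator S d) \<and>
       \<bar>metric S (grad_objective \<Omega> S') (replicator S d)\<bar>
         \<le> c2 * \<bar>metric S (grad_objective \<Omega> S) (replicator S d)\<bar>)"

text \<open>\<open>\<theta> k\<close> is the step size with which step \<open>k\<close> is performed.  The current step size at the
  start of step \<open>k\<close> is the one of the previous step, and \<open>1 / \<gamma>\<close> at the start of step \<open>0\<close>.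
  The bisection is represented by its specification: an admissible value in
  \<open>[1 / \<gamma>, 1 / \<bar>\<lambda>\<^sub>m\<^sub>i\<^sub>n\<bar>]\<close>.\<close>

definition current_step :: "real \<Rightarrow> (nat \<Rightarrow> real) \<Rightarrow> nat \<Rightarrow> real" where
  "current_step \<gamma> \<theta> k = (case k of 0 \<Rightarrow> 1 / \<gamma> | Suc i \<Rightarrow> \<theta> i)"

definition accelerated_DC_run ::
    "real^'v^'v \<Rightarrow> real^'c^'v \<Rightarrow> real \<Rightarrow> real \<Rightarrow> real \<Rightarrow>
     (nat \<Rightarrow> real^'c^'v) \<Rightarrow> (nat \<Rightarrow> real) \<Rightarrow> (nat \<Rightarrow> real) \<Rightarrow> bool" where
  "accelerated_DC_run \<Omega> DX c1 c2 \<gamma> S \<theta> h \<longleftrightarrow>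
     0 < c1 \<and> c1 < c2 \<and> c2 < 1 \<and>
     0 < \<bar>lambda_min \<Omega>\<bar> \<and> \<bar>lambda_min \<Omega>\<bar> < \<gamma> \<and>
     S 0 = lift_exp_rows barycenter (- (\<Omega> ** DX)) \<and>
     (\<forall>k. let d = descent_direction \<Omega> (S k) (h k);
              ok = line_search_conditions \<Omega> c1 c2 (S k) d;
              cur = current_step \<gamma> \<theta> k in
        admissible_h \<Omega> (S k) (h k) \<and>
        (if ok cur then \<theta> k = cur
         else \<theta> k \<in> {1 / \<gamma> .. 1 / \<bar>lambda_min \<Omega>\<bar>} \<and> ok (\<theta> k)) \<and>
        S (Suc k) = lift_exp_rows (S k) (\<theta> k *\<^sub>R d))"

definition limit_points :: "(nat \<Rightarrow> real^'c^'v) \<Rightarrow> (real^'c^'v) set" where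
  "limit_points S =
     {P \<in> closure assignment_manifold. \<exists>r. strict_mono r \<and> (\<lambda>l. S (r l)) \<longlonglongrightarrow> P}"

end

theory Submission
  imports Defs
begin

text \<open>
  The iterates multiply each row entry by \<open>exp\<close> of a step and renormalise, so the relative entropy
  \<open>KL(P, S\<^sup>k)\<close> changes per step by \<open>\<Sum>\<^sub>x ln \<langle>S\<^sup>k(x), exp W(x)\<rangle> - \<langle>P, W\<rangle>\<close>, where \<open>W\<close> is the step.  Up to
  the variance of \<open>W\<close> under \<open>S\<^sup>k\<close> this is \<open>\<langle>S\<^sup>k - P, W\<rangle>\<close> (\<open>KL_divergence_step_le\<close>).  Two kinds of error
  arise and both are summable.  The contribution of the acceleration term is of order \<open>h\<^sub>k\<close>.  The
  variance is of the order of \<open>\<parallel>grad J(S\<^sup>k)\<parallel>\<^sup>2 + h\<^sub>k\<close>, and the sufficient decrease condition of the line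
  search makes \<open>J\<close> fall by a fixed fraction of \<open>\<parallel>grad J(S\<^sup>k)\<parallel>\<^sup>2\<close> (\<open>objective_decrease\<close>), so that these
  squared norms have a finite sum.  In particular every limit point \<open>P\<close> is an equilibrium.

  The main term is \<open>\<theta> \<langle>S - P, \<Omega> S\<rangle>\<close>.  As \<open>\<Omega>\<close> is symmetric and \<open>J(S\<^sup>k)\<close> decreases to \<open>J(P)\<close>, it is at
  most \<open>- \<theta> \<Sum> S\<^sub>j(x) \<nu>\<^sub>j(x)\<close>, where \<open>\<nu>\<^sub>j(x)\<close> is the excess of \<open>(\<Omega> P)\<^sub>j(x)\<close> over its mean in row \<open>x\<close>
  (\<open>inner_gap_le_growth\<close>).  Entries with \<open>\<nu> > 0\<close> help.  Entries with \<open>\<nu> < 0\<close> may increase the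
  relative entropy, but by an amount linear in the entry, and near \<open>P\<close> these entries decay
  geometrically, with an exponent of order \<open>\<theta> |\<nu>|\<close>.  Adding a large multiple of their sum to \<open>KL(P, S)\<close> therefore gives
  a function that decreases near \<open>P\<close> up to summable errors (\<open>lyapunov_step_le\<close>).  It tends to zero along
  the subsequence that converges to \<open>P\<close>, since \<open>\<nu> < 0\<close> forces \<open>P\<^sub>j(x) = 0\<close> at an equilibrium, and it
  dominates the squared distance to \<open>P\<close>.  Once it is small it hence stays small and the iterates
  cannot leave the neighbourhood again, so the whole sequence converges
  (\<open>local_quasi_Fejer_convergence\<close>).
\<close>

section \<open>Matrices with rows in the probability simplex\<close>

definition row_simplex :: "(real^'c^'v) set" where
  "row_simplex = {S. \<forall>x. S $ x \<in> prob_simplex}"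

text \<open>
  Centring is done with respect to the row means of \<open>W\<close> under the probability vectors \<open>S(x)\<close>.  The
  entries of \<open>centred S (\<Omega> S)\<close> are the per-capita growth rates of the replicator flow.
\<close>

definition centred :: "real^'c^'v \<Rightarrow> real^'c^'v \<Rightarrow> real^'c^'v" where
  "centred S W = (\<chi> x j. W $ x $ j - (\<Sum>i\<in>UNIV. S $ x $ i * W $ x $ i))"

lemma centred_nth:
  "centred S W $ x $ j = W $ x $ j - (\<Sum>i\<in>UNIV. S $ x $ i * W $ x $ i)"
  by (simp add: centred_def)

lemma row_simplexD:
  assumes "S \<in> row_simplex"
  shows "0 \<le> S $ x $ j" "(\<Sum>j\<in>UNIV. S $ x $ j) = 1" "S $ x $ j \<le> 1"
proof -
  show a: "0 \<le> S $ x $ j" and b: "(\<Sum>j\<in>UNIV. S $ x $ j) = 1" for j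
    using assms by (auto simp: row_simplex_def prob_simplex_def)
  show "S $ x $ j \<le> 1"
    using member_le_sum[of j UNIV "\<lambda>j. S $ x $ j"] a b by auto
qed

lemma sum_centred:
  assumes "S \<in> row_simplex"
  shows "(\<Sum>j\<in>UNIV. S $ x $ j * centred S W $ x $ j) = 0"
  using row_simplexD(2)[OF assms, of x]
  by (simp add: centred_nth right_diff_distrib sum_subtractf flip: sum_distrib_right)

lemma row_mean_abs_le:
  assumes "S \<in> row_simplex" "\<And>i. \<bar>W $ x $ i\<bar> \<le> B"
  shows "\<bar>\<Sum>i\<in>UNIV. S $ x $ i * W $ x $ i\<bar> \<le> B"
proof -
  have "\<bar>\<Sum>i\<in>UNIV. S $ x $ i * W $ x $ i\<bar> \<le> (\<Sum>i\<in>UNIV. S $ x $ i * B)"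
    using assms row_simplexD(1)[OF assms(1)]
    by (intro order.trans[OF sum_abs] sum_mono) (auto simp: abs_mult intro!: mult_left_mono)
  also have "\<dots> = B"
    using row_simplexD(2)[OF assms(1), of x] by (simp flip: sum_distrib_right)
  finally show ?thesis .
qed

lemma replicator_nth: "replicator S W $ x $ j = S $ x $ j * centred S W $ x $ j"
proof -
  have "replicator S W $ x $ j = (\<Sum>i\<in>UNIV. (if j = i then S $ x $ j * W $ x $ i else 0)
          - S $ x $ j * (S $ x $ i * W $ x $ i))"
    unfolding replicator_def replicator_matrix_def matrix_vector_mult_def
    by (auto simp: left_diff_distrib intro!: sum.cong)
  then show ?thesis
    by (simp add: sum_subtractf centred_nth right_diff_distrib flip: sum_distrib_left)
qed

lemma replicator_tangent:
  assumes "S \<in> row_simplex"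
  shows "replicator S W \<in> tangent_space"
  by (simp add: tangent_space_def replicator_nth sum_centred[OF assms])

text \<open>
  The replicator operator turns the Euclidean gradient into the Riemannian one: pairing with a
  tangent vector, the division by \<open>S\<close> cancels and the row means drop out.
\<close>

lemma metric_replicator:
  assumes "\<And>x j. 0 < S $ x $ j" "U \<in> tangent_space"
  shows "metric S U (replicator S W) = U \<bullet> W"
proof -
  have "(\<Sum>j\<in>UNIV. U $ x $ j * replicator S W $ x $ j / S $ x $ j)
      = (\<Sum>j\<in>UNIV. U $ x $ j * W $ x $ j)" for x
  proof -
    have "U $ x $ j * replicator S W $ x $ j / S $ x $ j
        = U $ x $ j * W $ x $ j - U $ x $ j * (\<Sum>i\<in>UNIV. S $ x $ i * W $ x $ i)" for j
      using less_imp_neq[OF assms(1)[of x j]] by (simp add: replicator_nth) (simp add: centred_nth right_diff_distrib)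
    moreover have "(\<Sum>j\<in>UNIV. U $ x $ j * m) = 0" for m
      using assms(2) by (simp add: tangent_space_def flip: sum_distrib_right)
    ultimately show ?thesis by (simp add: sum_subtractf)
  qed
  then show ?thesis by (simp add: metric_def inner_vec_def)
qed

text \<open>
  Row by row, the squared Riemannian norm of \<open>R\<^sub>S W\<close> is the variance of \<open>W\<close> under \<open>S\<close>.
\<close>

lemma metric_norm_sq_replicator:
  assumes "\<And>x j. 0 < S $ x $ j"
  shows "metric_norm_sq S (replicator S W)
    = (\<Sum>x\<in>UNIV. \<Sum>j\<in>UNIV. S $ x $ j * (centred S W $ x $ j)\<^sup>2)"
  unfolding metric_norm_sq_def metric_def
  using less_imp_neq[OF assms]
  by (intro sum.cong refl) (simp add: replicator_nth power2_eq_square)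

lemma norm_replicator_le:
  assumes "\<And>x j. 0 < S $ x $ j" "S \<in> row_simplex"
  shows "(norm (replicator S W))\<^sup>2 \<le> metric_norm_sq S (replicator S W)"
proof -
  have "(S $ x $ j)\<^sup>2 \<le> S $ x $ j" for x j
    using row_simplexD(1,3)[OF assms(2), of x j] mult_right_mono[of "S$x$j" 1 "S$x$j"] assms
    by (simp add: power2_eq_square)
  then show ?thesis
    unfolding power2_norm_eq_inner metric_norm_sq_replicator[OF assms(1)] inner_vec_def
    by (auto intro!: sum_mono mult_right_mono simp: replicator_nth power_mult_distrib simp flip: power2_eq_square)
qed

lemma lift_exp_rows_nth:
  "lift_exp_rows S W $ x $ j = S $ x $ j * exp (W $ x $ j) / (\<Sum>i\<in>UNIV. S $ x $ i * exp (W $ x $ i))"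
  by (simp add: lift_exp_rows_def lift_exp_def)

lemma lift_exp_rows_shift:
  assumes "\<And>x j. W' $ x $ j = W $ x $ j + m x"
  shows "lift_exp_rows S W' = lift_exp_rows S W"
  by (simp add: vec_eq_iff lift_exp_rows_nth assms exp_add flip: mult.assoc sum_distrib_right)

lemma lift_exp_rows_interior:
  fixes S W :: "real^'c^'v"
  assumes "\<And>x j. 0 < S $ x $ j"
  shows "0 < lift_exp_rows S W $ x $ j" "lift_exp_rows S W \<in> row_simplex"
proof -
  have Z: "0 < (\<Sum>i\<in>UNIV. S $ x $ i * exp (W $ x $ i))" for x
    using assms by (intro sum_pos) auto
  then show pos: "0 < lift_exp_rows S W $ x $ j" for x j
    using assms by (simp add: lift_exp_rows_nth)
  have "(\<Sum>j\<in>UNIV. lift_exp_rows S W $ x $ j) = 1" for x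
    using Z[of x] by (simp add: lift_exp_rows_nth flip: sum_divide_distrib)
  then show "lift_exp_rows S W \<in> row_simplex"
    using pos by (auto simp: row_simplex_def prob_simplex_def less_imp_le)
qed

text \<open>
  Inside the affine hull, where entries still sum to one, a perturbation smaller than the least
  entry of \<open>p\<close> keeps all entries nonnegative.
\<close>

lemma positive_imp_rel_interior_simplex:
  fixes p :: "real^'c"
  assumes "\<And>j. 0 < p $ j" "(\<Sum>j\<in>UNIV. p $ j) = 1"
  shows "p \<in> rel_interior prob_simplex"
proof -
  have "affine {q::real^'c. (\<Sum>j\<in>UNIV. q $ j) = 1}"
    by (auto simp: affine_def sum.distrib simp flip: sum_distrib_left)
  then have hull: "affine hull prob_simplex \<subseteq> {q::real^'c. (\<Sum>j\<in>UNIV. q $ j) = 1}"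
    by (intro hull_minimal) (auto simp: prob_simplex_def)
  define e where "e = Min (range (\<lambda>j. p $ j))"
  have "0 < e" "e \<le> p $ j" for j
    using assms(1) by (auto simp: e_def)
  have "ball p e \<inter> affine hull prob_simplex \<subseteq> prob_simplex"
  proof
    fix q assume q: "q \<in> ball p e \<inter> affine hull prob_simplex"
    have "0 \<le> q $ j" for j
    proof -
      have "\<bar>(p - q) $ j\<bar> < e"
        using q component_le_norm_cart[of "p - q" j] by (simp add: dist_norm)
      then show ?thesis using \<open>e \<le> p $ j\<close> by simp
    qed
    then show "q \<in> prob_simplex"
      using q hull by (auto simp: prob_simplex_def)
  qed
  moreover have "p \<in> prob_simplex"
    using assms by (auto simp: prob_simplex_def less_imp_le)
  ultimately show ?thesis
    using \<open>0 < e\<close> by (auto simp: mem_rel_interior_ball)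
qed

lemma interior_in_assignment_manifold:
  assumes "S \<in> row_simplex" "\<And>x j. 0 < S $ x $ j"
  shows "S \<in> assignment_manifold"
  unfolding assignment_manifold_def
  using positive_imp_rel_interior_simplex[OF assms(2) row_simplexD(2)[OF assms(1)]] by blast

lemma abs_inner_le_entries:
  fixes U W :: "real^'c^'v"
  assumes "\<And>x j. \<bar>U $ x $ j\<bar> \<le> a" "\<And>x j. \<bar>W $ x $ j\<bar> \<le> b"
  shows "\<bar>U \<bullet> W\<bar> \<le> real CARD('v) * (real CARD('c) * (a * b))"
proof -
  have "0 \<le> a" using order.trans[OF abs_ge_zero assms(1)] .
  have "\<bar>U \<bullet> W\<bar> \<le> (\<Sum>x\<in>(UNIV::'v set). \<Sum>j\<in>(UNIV::'c set). a * b)"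
    unfolding inner_vec_def
    by (intro order.trans[OF sum_abs] sum_mono)
       (auto simp: abs_mult intro!: mult_mono assms \<open>0 \<le> a\<close>)
  then show ?thesis by simp
qed

lemma compact_row_simplex: "compact (row_simplex :: (real^'c^'v) set)"
proof -
  have eq: "row_simplex = (\<Inter>x. (\<Inter>j. {S::real^'c^'v. 0 \<le> S $ x $ j}) \<inter> {S. (\<Sum>j\<in>UNIV. S $ x $ j) = 1})"
    by (auto simp: row_simplex_def prob_simplex_def)
  have "closed (row_simplex :: (real^'c^'v) set)"
    unfolding eq
    by (intro closed_INT ballI closed_Int closed_Collect_le closed_Collect_eq continuous_intros)
  moreover have "norm S \<le> sqrt (real CARD('v) * real CARD('c))" if "S \<in> row_simplex" for S :: "real^'c^'v"
    using abs_inner_le_entries[of S 1 S 1] row_simplexD[OF that]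
    by (intro real_le_rsqrt) (simp add: power2_norm_eq_inner)
  ultimately show ?thesis
    unfolding compact_eq_bounded_closed bounded_iff by blast
qed

section \<open>Relative entropy along an exponential step\<close>

lemma exp_le_quadratic:
  fixes u M :: real
  assumes "\<bar>u\<bar> \<le> M"
  shows "exp u \<le> 1 + u + exp M * u\<^sup>2"
proof -
  obtain t where t: "\<bar>t\<bar> \<le> \<bar>u\<bar>" "exp u = (\<Sum>m<2. u ^ m / fact m) + exp t / fact 2 * u\<^sup>2"
    using Maclaurin_exp_le[of u 2] by auto
  have "exp t / 2 \<le> exp M"
    using t(1) assms by (smt (verit) exp_ge_zero exp_le_cancel_iff field_sum_of_halves)
  then have "exp t / 2 * u\<^sup>2 \<le> exp M * u\<^sup>2"
    by (rule mult_right_mono) simp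
  then show ?thesis
    using t(2) by (simp add: numeral_2_eq_2)
qed

text \<open>
  After factoring out \<open>exp\<close> of the mean, the normalising sum is the expectation of \<open>exp\<close> of a centred
  quantity \<open>u\<close>.  The bound \<open>1 + u \<le> exp u\<close> gives Jensen's inequality, and \<open>exp u \<le> 1 + u + C u\<^sup>2\<close> its
  reverse up to the variance; the linear term has expectation zero in both cases.
\<close>

lemma normalizer_bounds:
  fixes S W :: "real^'c^'v"
  assumes S: "S \<in> row_simplex"
  defines "m \<equiv> \<lambda>x. \<Sum>i\<in>UNIV. S $ x $ i * W $ x $ i"
  defines "Z \<equiv> \<lambda>x. \<Sum>i\<in>UNIV. S $ x $ i * exp (W $ x $ i)"
  shows "exp (m x) \<le> Z x"
    and "(\<And>j. \<bar>centred S W $ x $ j\<bar> \<le> M) \<Longrightarrow>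
      ln (Z x) \<le> m x + exp M * (\<Sum>j\<in>UNIV. S $ x $ j * (centred S W $ x $ j)\<^sup>2)"
proof -
  define Y where "Y = (\<Sum>i\<in>UNIV. S $ x $ i * exp (centred S W $ x $ i))"
  have ZY: "Z x = exp (m x) * Y"
    unfolding Z_def Y_def m_def centred_nth sum_distrib_left
    by (intro sum.cong refl) (simp add: exp_diff)
  have "(\<Sum>i\<in>UNIV. S $ x $ i * (1 + centred S W $ x $ i)) \<le> Y"
    unfolding Y_def using row_simplexD(1)[OF S]
    by (intro sum_mono mult_left_mono) auto
  then have Y1: "1 \<le> Y"
    by (simp add: distrib_left sum.distrib sum_centred[OF S] row_simplexD(2)[OF S])
  then show "exp (m x) \<le> Z x" unfolding ZY by simp
  assume M: "\<And>j. \<bar>centred S W $ x $ j\<bar> \<le> M"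
  have "Y \<le> (\<Sum>i\<in>UNIV. S $ x $ i * (1 + centred S W $ x $ i + exp M * (centred S W $ x $ i)\<^sup>2))"
    unfolding Y_def using row_simplexD(1)[OF S] exp_le_quadratic[OF M]
    by (intro sum_mono mult_left_mono) auto
  also have "\<dots> = 1 + exp M * (\<Sum>j\<in>UNIV. S $ x $ j * (centred S W $ x $ j)\<^sup>2)"
    by (simp add: distrib_left sum.distrib sum_centred[OF S] row_simplexD(2)[OF S]
        sum_distrib_left mult.left_commute)
  finally have "ln Y \<le> exp M * (\<Sum>j\<in>UNIV. S $ x $ j * (centred S W $ x $ j)\<^sup>2)"
    using ln_le_minus_one[of Y] Y1 by linarith
  moreover have "ln (Z x) = m x + ln Y"
    unfolding ZY using Y1 by (simp add: ln_mult)
  ultimately show "ln (Z x) \<le> m x + exp M * (\<Sum>j\<in>UNIV. S $ x $ j * (centred S W $ x $ j)\<^sup>2)"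
    by simp
qed

text \<open>
  Entries whose step lies below the row mean shrink by a definite factor.
\<close>

lemma lift_exp_rows_component_le:
  assumes "S \<in> row_simplex"
  shows "lift_exp_rows S W $ x $ j \<le> S $ x $ j * exp (centred S W $ x $ j)"
proof -
  define m where "m = (\<Sum>i\<in>UNIV. S $ x $ i * W $ x $ i)"
  have "S $ x $ j * exp (W $ x $ j) / (\<Sum>i\<in>UNIV. S $ x $ i * exp (W $ x $ i))
      \<le> S $ x $ j * exp (W $ x $ j) / exp m"
    using normalizer_bounds(1)[OF assms, of x W] row_simplexD(1)[OF assms]
    unfolding m_def by (intro divide_left_mono) (auto intro: mult_pos_pos less_le_trans[OF exp_gt_zero])
  then show ?thesis
    by (simp add: lift_exp_rows_nth centred_nth exp_diff m_def)
qed

lemma KL_divergence_step_le: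
  fixes S P W :: "real^'c^'v"
  assumes S: "S \<in> row_simplex" and pos: "\<And>x j. 0 < S $ x $ j" and P: "P \<in> row_simplex"
    and M: "\<And>x j. \<bar>centred S W $ x $ j\<bar> \<le> M"
  shows "KL_divergence P (lift_exp_rows S W) - KL_divergence P S
    \<le> (S - P) \<bullet> W + exp M * (\<Sum>x\<in>UNIV. \<Sum>j\<in>UNIV. S $ x $ j * (centred S W $ x $ j)\<^sup>2)"
proof -
  define Z where "Z = (\<lambda>x. \<Sum>i\<in>UNIV. S $ x $ i * exp (W $ x $ i))"
  have Z: "0 < Z x" for x
    unfolding Z_def using pos by (intro sum_pos) auto
  have entry: "P $ x $ j * ln (P $ x $ j / lift_exp_rows S W $ x $ j) - P $ x $ j * ln (P $ x $ j / S $ x $ j)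
      = P $ x $ j * ln (Z x) - P $ x $ j * W $ x $ j" for x j
  proof (cases "P $ x $ j = 0")
    case False
    then have "0 < P $ x $ j" using row_simplexD(1)[OF P, of x j] by simp
    then show ?thesis
      using pos[of x j] Z[of x] less_imp_neq[OF Z[of x]]
      by (simp add: lift_exp_rows_nth ln_div ln_mult algebra_simps flip: fun_cong[OF Z_def])
  qed simp
  have "KL_divergence P (lift_exp_rows S W) - KL_divergence P S
      = (\<Sum>x\<in>UNIV. ln (Z x) - (\<Sum>j\<in>UNIV. P $ x $ j * W $ x $ j))"
    unfolding KL_divergence_def
    by (simp add: entry row_simplexD(2)[OF P] flip: sum_subtractf sum_distrib_right)
       (simp add: sum_subtractf row_simplexD(2)[OF P] flip: sum_distrib_right)
  also have "\<dots> \<le> (\<Sum>x\<in>UNIV. ((\<Sum>j\<in>UNIV. S $ x $ j * W $ x $ j)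
      + exp M * (\<Sum>j\<in>UNIV. S $ x $ j * (centred S W $ x $ j)\<^sup>2)) - (\<Sum>j\<in>UNIV. P $ x $ j * W $ x $ j))"
    unfolding Z_def by (intro sum_mono diff_right_mono normalizer_bounds(2)[OF S] M)
  also have "\<dots> = (S - P) \<bullet> W + exp M * (\<Sum>x\<in>UNIV. \<Sum>j\<in>UNIV. S $ x $ j * (centred S W $ x $ j)\<^sup>2)"
    unfolding inner_diff_left
    by (simp add: inner_vec_def sum.distrib sum_subtractf sum_distrib_left)
  finally show ?thesis .
qed

text \<open>
  One entry of the bound of the relative entropy by the squared Hellinger distance: \<open>ln t \<le> t - 1\<close> at
  \<open>t = sqrt (q / p)\<close> gives \<open>p ln (p / q) \<ge> (p - q) + (sqrt p - sqrt q)\<^sup>2\<close>, and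
  \<open>|p - q| \<le> 2 |sqrt p - sqrt q|\<close> on the unit interval.  The linear term \<open>p - q\<close> cancels when the
  entries of a row are summed.
\<close>

lemma hellinger_term_le:
  fixes p q :: real
  assumes "0 \<le> p" "p \<le> 1" "0 < q" "q \<le> 1"
  shows "(p - q)\<^sup>2 / 4 + (p - q) \<le> p * ln (p / q)"
proof -
  define a b where "a = sqrt p" and "b = sqrt q"
  have ab: "p = a\<^sup>2" "q = b\<^sup>2" "0 \<le> a" "a \<le> 1" "0 < b" "b \<le> 1"
    using assms by (auto simp: a_def b_def)
  have "(a + b)\<^sup>2 \<le> 2\<^sup>2" using ab by (intro power_mono) auto
  then have "(a - b)\<^sup>2 * (a + b)\<^sup>2 \<le> (a - b)\<^sup>2 * 4"
    by (intro mult_left_mono) auto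
  moreover have "(p - q)\<^sup>2 = (a - b)\<^sup>2 * (a + b)\<^sup>2"
    unfolding ab by (simp add: power2_eq_square algebra_simps)
  ultimately have 1: "(p - q)\<^sup>2 / 4 \<le> (a - b)\<^sup>2" by simp
  have "(a - b)\<^sup>2 + (p - q) \<le> p * ln (p / q)"
  proof (cases "p = 0")
    case False
    then have "0 < a" using ab by auto
    have "ln (b / a) \<le> b / a - 1"
      using \<open>0 < a\<close> ab by (intro ln_le_minus_one) auto
    then have "2 * a\<^sup>2 * ln (b / a) \<le> 2 * a\<^sup>2 * (b / a - 1)"
      by (intro mult_left_mono) auto
    moreover have "2 * a\<^sup>2 * (b / a - 1) = 2 * a * b - 2 * a\<^sup>2"
      using \<open>0 < a\<close> by (simp add: field_simps power2_eq_square)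
    moreover have "p * ln (p / q) = - (2 * a\<^sup>2 * ln (b / a))"
      using \<open>0 < a\<close> ab by (simp add: ln_div ln_realpow right_diff_distrib)
    ultimately have "2 * a\<^sup>2 - 2 * a * b \<le> p * ln (p / q)" by linarith
    then show ?thesis
      unfolding ab(1,2)[symmetric] using ab(1,2) by (simp add: power2_diff)
  qed (use ab in auto)
  with 1 show ?thesis by simp
qed

lemma norm_sq_le_KL_divergence:
  fixes P S :: "real^'c^'v"
  assumes P: "P \<in> row_simplex" and S: "S \<in> row_simplex" and pos: "\<And>x j. 0 < S $ x $ j"
  shows "(norm (S - P))\<^sup>2 \<le> 4 * KL_divergence P S"
proof -
  have "(\<Sum>x\<in>UNIV. \<Sum>j\<in>UNIV. (P $ x $ j - S $ x $ j)\<^sup>2 / 4 + (P $ x $ j - S $ x $ j)) \<le> KL_divergence P S"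
    unfolding KL_divergence_def
    by (intro sum_mono hellinger_term_le row_simplexD[OF P] row_simplexD[OF S] pos)
  also have "(\<Sum>x\<in>UNIV. \<Sum>j\<in>UNIV. (P $ x $ j - S $ x $ j)\<^sup>2 / 4 + (P $ x $ j - S $ x $ j))
      = (norm (P - S))\<^sup>2 / 4"
    by (simp add: sum.distrib sum_subtractf row_simplexD(2)[OF P] row_simplexD(2)[OF S]
        power2_norm_eq_inner inner_vec_def flip: sum_divide_distrib power2_eq_square)
  finally show ?thesis by (simp add: norm_minus_commute)
qed

lemma KL_divergence_tendsto_0:
  fixes P :: "real^'c^'v"
  assumes "(S \<longlongrightarrow> P) F"
  shows "((\<lambda>k. KL_divergence P (S k)) \<longlongrightarrow> 0) F"
proof -
  have "((\<lambda>k. P $ x $ j * ln (P $ x $ j / S k $ x $ j)) \<longlongrightarrow> 0) F" for x j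
  proof (cases "P $ x $ j = 0")
    case False
    then have "((\<lambda>k. P $ x $ j * ln (P $ x $ j / S k $ x $ j)) \<longlongrightarrow> P $ x $ j * ln (P $ x $ j / P $ x $ j)) F"
      by (intro tendsto_intros assms) auto
    then show ?thesis using False by simp
  qed simp
  then show ?thesis
    unfolding KL_divergence_def by (intro tendsto_null_sum)
qed

section \<open>Convergence from a local Lyapunov function\<close>

text \<open>
  A Lyapunov function that decreases only near \<open>p\<close>, up to summable errors, suffices.  Choose a
  member of the subsequence at which both \<open>L\<close> and the remaining errors are small.  As \<open>L\<close> controls the
  distance to \<open>p\<close>, by induction no later iterate leaves the neighbourhood in which \<open>L\<close> decreases.
\<close>

lemma local_quasi_Fejer_convergence:
  fixes s :: "nat \<Rightarrow> 'a::metric_space" and L e :: "nat \<Rightarrow> real"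
  assumes step: "\<And>k. k0 \<le> k \<Longrightarrow> dist (s k) p < \<delta> \<Longrightarrow> L (Suc k) \<le> L k + e k"
    and "0 < \<delta>"
    and coercive: "\<And>k. (dist (s k) p)\<^sup>2 \<le> C * L k" and C: "0 < C"
    and e: "\<And>k. 0 \<le> e k" "summable e"
    and r: "strict_mono r" "(\<lambda>l. L (r l)) \<longlonglongrightarrow> 0"
  shows "s \<longlonglongrightarrow> p"
proof (rule metric_LIMSEQ_I)
  fix \<epsilon>' :: real assume "0 < \<epsilon>'"
  define \<epsilon> where "\<epsilon> = min \<epsilon>' \<delta>"
  have \<epsilon>: "0 < \<epsilon>" "\<epsilon> \<le> \<epsilon>'" "\<epsilon> \<le> \<delta>"
    using \<open>0 < \<epsilon>'\<close> \<open>0 < \<delta>\<close> by (auto simp: \<epsilon>_def)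
  define \<eta> where "\<eta> = \<epsilon>\<^sup>2 / C"
  have \<eta>: "0 < \<eta>" using \<epsilon> C by (simp add: \<eta>_def)
  have near: "dist (s k) p < \<epsilon>" if "L k < \<eta>" for k
  proof (rule power2_less_imp_less)
    have "C * L k < C * \<eta>" using that C by simp
    then show "(dist (s k) p)\<^sup>2 < \<epsilon>\<^sup>2"
      using coercive[of k] C by (simp add: \<eta>_def)
  qed (use \<epsilon> in simp)
  obtain N where N: "\<And>m n. N \<le> m \<Longrightarrow> norm (sum e {m..<n}) < \<eta> / 2"
    using e(2) \<eta> unfolding summable_Cauchy by (meson half_gt_zero)
  have "\<forall>\<^sub>F l in sequentially. L (r l) < \<eta> / 2"
    using r(2) \<eta> by (intro order_tendstoD(2)) auto
  then obtain l where l: "max N k0 \<le> l" "L (r l) < \<eta> / 2"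
    unfolding eventually_sequentially by (meson max.cobounded1 max.cobounded2 order.refl)
  define m where "m = r l"
  have m: "N \<le> m" "k0 \<le> m" "L m < \<eta> / 2"
    using l seq_suble[OF r(1), of l] by (auto simp: m_def)
  have bound: "L k \<le> L m + sum e {m..<k}" if "m \<le> k" for k
    using that
  proof (induction k rule: dec_induct)
    case (step k)
    have "sum e {m..<k} < \<eta> / 2" using N[OF m(1), of k] by simp
    then have "dist (s k) p < \<delta>" using step m(3) near[of k] \<epsilon>(3) by simp
    then show ?case using assms(1)[of k] step m(2) by simp
  qed simp
  have "dist (s k) p < \<epsilon>'" if "m \<le> k" for k
    using near[of k] bound[OF that] abs_le_D1[OF order.refl, of "sum e {m..<k}"]
      N[OF m(1), of k] m(3) \<epsilon>(2) by (simp only: real_norm_def) linarith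
  then show "\<exists>no. \<forall>n\<ge>no. dist (s n) p < \<epsilon>'" by blast
qed

section \<open>Weight matrices\<close>

lemma matrix_matrix_mult_nth: "(A ** M) $ x $ j = (\<Sum>y\<in>UNIV. A $ x $ y * M $ y $ j)"
  by (simp add: matrix_matrix_mult_def)

lemma stochastic_mult_abs_le:
  fixes A :: "real^'v^'v" and M :: "real^'c^'v"
  assumes "\<And>x y. 0 \<le> A $ x $ y" "\<And>x. (\<Sum>y\<in>UNIV. A $ x $ y) = 1" "\<And>y j. \<bar>M $ y $ j\<bar> \<le> B"
  shows "\<bar>(A ** M) $ x $ j\<bar> \<le> B"
proof -
  have "\<bar>(A ** M) $ x $ j\<bar> \<le> (\<Sum>y\<in>UNIV. A $ x $ y * B)"
    unfolding matrix_matrix_mult_nth using assms(1,3)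
    by (intro order.trans[OF sum_abs] sum_mono) (auto simp: abs_mult intro!: mult_left_mono)
  then show ?thesis by (simp add: assms(2) flip: sum_distrib_right)
qed

lemma inner_matrix_mult_left:
  fixes A :: "real^'v^'v" and U W :: "real^'c^'v"
  shows "U \<bullet> (A ** W) = (transpose A ** U) \<bullet> W"
proof -
  have "U \<bullet> (A ** W) = (\<Sum>x\<in>UNIV. \<Sum>j\<in>UNIV. \<Sum>y\<in>UNIV. A $ x $ y * U $ x $ j * W $ y $ j)"
    by (simp add: inner_vec_def matrix_matrix_mult_nth sum_distrib_left mult_ac)
  also have "\<dots> = (\<Sum>j\<in>UNIV. \<Sum>x\<in>UNIV. \<Sum>y\<in>UNIV. A $ x $ y * U $ x $ j * W $ y $ j)"
    by (rule sum.swap)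
  also have "\<dots> = (\<Sum>j\<in>UNIV. \<Sum>y\<in>UNIV. \<Sum>x\<in>UNIV. A $ x $ y * U $ x $ j * W $ y $ j)"
    by (intro sum.cong refl sum.swap)
  also have "\<dots> = (\<Sum>y\<in>UNIV. \<Sum>j\<in>UNIV. \<Sum>x\<in>UNIV. A $ x $ y * U $ x $ j * W $ y $ j)"
    by (rule sum.swap)
  also have "\<dots> = (transpose A ** U) \<bullet> W"
    by (simp add: inner_vec_def matrix_matrix_mult_nth transpose_def sum_distrib_right)
  finally show ?thesis .
qed

lemma weight_matrix_symmetric:
  assumes "nonlocal_kernels V \<alpha> \<Theta>" "range vert \<subseteq> V"
  shows "transpose (weight_matrix vert \<alpha> \<Theta>) = weight_matrix vert \<alpha> \<Theta>"
proof -
  have "\<Theta> (vert x) (vert y) = \<Theta> (vert y) (vert x)" "\<alpha> (vert x) (vert y) = - \<alpha> (vert y) (vert x)" for x y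
    using assms unfolding nonlocal_kernels_def Let_def by blast+
  then have "\<Theta> (vert x) (vert y) * (\<alpha> (vert x) (vert y))\<^sup>2 = \<Theta> (vert y) (vert x) * (\<alpha> (vert y) (vert x))\<^sup>2" for x y
    by (metis power2_minus)
  then show ?thesis
    unfolding vec_eq_iff transpose_def weight_matrix_def
    by simp
qed

lemma tendsto_matrix_mult:
  fixes A :: "real^'v^'v"
  assumes "(S \<longlongrightarrow> P) F"
  shows "((\<lambda>k. A ** S k) \<longlongrightarrow> A ** P) F"
  by (intro vec_tendstoI) (auto simp: matrix_matrix_mult_nth intro!: tendsto_intros assms)

lemma tendsto_centred:
  assumes "(S \<longlongrightarrow> P) F" "(W \<longlongrightarrow> Q) F"
  shows "((\<lambda>k. centred (S k) (W k) $ x $ j) \<longlongrightarrow> centred P Q $ x $ j) F"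
  unfolding centred_nth by (intro tendsto_intros assms)

lemma tendsto_replicator:
  assumes "(S \<longlongrightarrow> P) F" "(W \<longlongrightarrow> Q) F"
  shows "((\<lambda>k. replicator (S k) (W k)) \<longlongrightarrow> replicator P Q) F"
  by (intro vec_tendstoI) (simp add: replicator_nth tendsto_mult tendsto_centred tendsto_vec_nth assms)

section \<open>Decrease of the objective\<close>

text \<open>
  The tangent projection only subtracts a constant from each row, which the normalisation in the
  exponential step cancels.
\<close>

lemma lift_exp_rows_descent_direction:
  fixes S :: "real^'c^'v"
  shows "lift_exp_rows S (\<theta> *\<^sub>R descent_direction \<Omega> S h)
    = lift_exp_rows S (\<theta> *\<^sub>R (\<Omega> ** S + (h / 2) *\<^sub>R (\<Omega> ** replicator S (\<Omega> ** S))))"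
  by (rule lift_exp_rows_shift[where m = "\<lambda>x. - \<theta> * ((\<Sum>i\<in>UNIV. (\<Omega> ** S) $ x $ i) / real CARD('c))"])
     (simp add: descent_direction_def proj_tangent_eq algebra_simps)

lemma inner_proj_tangent:
  assumes "U \<in> tangent_space"
  shows "U \<bullet> proj_tangent M = U \<bullet> M"
proof -
  have "(\<Sum>j\<in>UNIV. U $ x $ j * m) = 0" for x m
    using assms by (simp add: tangent_space_def flip: sum_distrib_right)
  then show ?thesis
    by (simp add: proj_tangent_eq inner_vec_def right_diff_distrib sum_subtractf del: times_divide_eq_right)
qed

lemma admissible_h_nonneg: "admissible_h \<Omega> S h \<Longrightarrow> 0 \<le> h"
  by (auto simp: admissible_h_def Let_def split: if_splits)

lemma metric_norm_sq_nonneg: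
  assumes "\<And>x j. 0 < S $ x $ j"
  shows "0 \<le> metric_norm_sq S U"
  unfolding metric_norm_sq_def metric_def
  using less_imp_le[OF assms] by (intro sum_nonneg) auto

text \<open>
  With \<open>G = R\<^sub>S(\<Omega> S)\<close>, the slope in the line search is \<open>- \<parallel>G\<parallel>\<^sup>2 - (h/2) \<langle>G, \<Omega> G\<rangle>\<close>.  Admissibility of \<open>h\<close>
  gives \<open>h |\<langle>G, \<Omega> G\<rangle>| \<le> \<parallel>G\<parallel>\<^sup>2\<close>, so at least half of the squared gradient norm survives the acceleration.
\<close>

lemma objective_decrease:
  fixes S :: "real^'c^'v" and \<Omega> :: "real^'v^'v"
  assumes S: "S \<in> row_simplex" and pos: "\<And>x j. 0 < S $ x $ j"
    and h: "admissible_h \<Omega> S h" and "0 \<le> \<theta>" "0 \<le> c1"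
    and ls: "line_search_conditions \<Omega> c1 c2 S (descent_direction \<Omega> S h) \<theta>"
  shows "objective \<Omega> (lift_exp_rows S (\<theta> *\<^sub>R descent_direction \<Omega> S h))
    \<le> objective \<Omega> S - c1 * \<theta> / 2 * metric_norm_sq S (replicator S (\<Omega> ** S))"
proof -
  define G where "G = replicator S (\<Omega> ** S)"
  define g where "g = metric_norm_sq S G"
  have G: "G \<in> tangent_space" "- G \<in> tangent_space"
    using replicator_tangent[OF S] by (auto simp: G_def tangent_space_def sum_negf)
  have g: "g = G \<bullet> (\<Omega> ** S)"
    using metric_replicator[OF pos G(1), of "\<Omega> ** S"] by (simp add: g_def metric_norm_sq_def G_def)
  have "metric S (grad_objective \<Omega> S) (replicator S (descent_direction \<Omega> S h))
      = - (G \<bullet> descent_direction \<Omega> S h)"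
    using metric_replicator[OF pos G(2)] by (simp add: grad_objective_def G_def)
  also have "\<dots> = - (g + h / 2 * (G \<bullet> (\<Omega> ** G)))"
    by (simp add: descent_direction_def inner_add_right inner_proj_tangent[OF G(1)] g flip: G_def)
  also have "\<dots> \<le> - g / 2"
  proof -
    have "h * \<bar>G \<bullet> (\<Omega> ** G)\<bar> \<le> g"
    proof (cases "G \<bullet> (\<Omega> ** G) = 0")
      case True
      then show ?thesis using metric_norm_sq_nonneg[OF pos] by (simp add: g_def)
    next
      case False
      then have "G \<noteq> 0" by auto
      then show ?thesis
        using h False by (simp add: admissible_h_def Let_def g_def G_def[symmetric] pos_less_divide_eq)
    qed
    moreover have "- (h * (G \<bullet> (\<Omega> ** G))) \<le> h * \<bar>G \<bullet> (\<Omega> ** G)\<bar>"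
      using mult_left_mono[OF abs_ge_minus_self admissible_h_nonneg[OF h], of "G \<bullet> (\<Omega> ** G)"] by simp
    ultimately show ?thesis by simp
  qed
  finally have "c1 * \<theta> * metric S (grad_objective \<Omega> S) (replicator S (descent_direction \<Omega> S h))
      \<le> c1 * \<theta> * (- g / 2)"
    using assms by (intro mult_left_mono) auto
  then show ?thesis
    using ls by (simp add: line_search_conditions_def Let_def g_def G_def)
qed

section \<open>The Lyapunov function near a limit point\<close>

text \<open>
  The second summand collects the entries that decay near \<open>P\<close>, with decay rate at least
  \<open>\<theta> |\<nu>| / 4\<close> in the exponent, where \<open>\<nu> = centred P (\<Omega> P)\<close>.  Its weight \<open>4 (1 + T)\<close>, with \<open>T\<close> an upper
  bound of the step sizes, makes one step of this decay outweigh the possible growth \<open>\<theta> |\<nu>| S\<close> of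
  the relative entropy.
\<close>

definition lyapunov :: "real^'v^'v \<Rightarrow> real \<Rightarrow> real^'c^'v \<Rightarrow> real^'c^'v \<Rightarrow> real" where
  "lyapunov \<Omega> T P S = KL_divergence P S + 4 * (1 + T) *
     (\<Sum>x\<in>UNIV. \<Sum>j\<in>UNIV. if centred P (\<Omega> ** P) $ x $ j < 0 then S $ x $ j else 0)"

text \<open>
  By symmetry, \<open>\<langle>S - P, \<Omega> S\<rangle> + \<langle>S - P, \<Omega> P\<rangle> = \<langle>S, \<Omega> S\<rangle> - \<langle>P, \<Omega> P\<rangle> \<le> 0\<close>, so the quadratic term can be traded
  for one that is linear in \<open>S\<close>.  The rows of \<open>S\<close> sum to one, hence \<open>\<langle>S - P, \<Omega> P\<rangle>\<close> is the sum of the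
  entries of \<open>S\<close> weighted with the growth rates at \<open>P\<close>.
\<close>

lemma inner_gap_le_growth:
  fixes S P :: "real^'c^'v" and \<Omega> :: "real^'v^'v"
  assumes sym: "transpose \<Omega> = \<Omega>" and S: "S \<in> row_simplex"
    and le: "S \<bullet> (\<Omega> ** S) \<le> P \<bullet> (\<Omega> ** P)"
  shows "(S - P) \<bullet> (\<Omega> ** S) \<le> - (\<Sum>x\<in>UNIV. \<Sum>j\<in>UNIV. S $ x $ j * centred P (\<Omega> ** P) $ x $ j)"
proof -
  have "(\<Sum>j\<in>UNIV. S $ x $ j * centred P W $ x $ j)
      = (\<Sum>j\<in>UNIV. S $ x $ j * W $ x $ j) - (\<Sum>j\<in>UNIV. P $ x $ j * W $ x $ j)" for x W
    using row_simplexD(2)[OF S, of x]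
    by (simp add: centred_nth right_diff_distrib sum_subtractf flip: sum_distrib_right)
  then have "(\<Sum>x\<in>UNIV. \<Sum>j\<in>UNIV. S $ x $ j * centred P (\<Omega> ** P) $ x $ j) = (S - P) \<bullet> (\<Omega> ** P)"
    by (simp only: inner_diff_left) (simp add: inner_vec_def sum_subtractf)
  moreover have "P \<bullet> (\<Omega> ** S) = S \<bullet> (\<Omega> ** P)"
    using inner_matrix_mult_left[of P \<Omega> S] by (simp add: sym inner_commute)
  ultimately show ?thesis
    using le by (simp add: inner_diff_left)
qed

text \<open>
  Converts the exponential decay of an entry into a decrease that is linear in its rate, with a
  constant uniform for rates up to \<open>T\<close>.
\<close>

lemma exp_minus_le:
  fixes x T :: real
  assumes "0 \<le> x" "x \<le> T"
  shows "x \<le> (1 + T) * (1 - exp (- x))"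
proof -
  have "(1 + x) * exp (- x) \<le> 1"
    using mult_right_mono[OF exp_ge_add_one_self[of x], of "exp (- x)"] by (simp flip: exp_add)
  then have "x \<le> (1 + x) * (1 - exp (- x))" by (simp add: algebra_simps)
  also have "\<dots> \<le> (1 + T) * (1 - exp (- x))"
    using assms by (intro mult_right_mono) auto
  finally show ?thesis .
qed

text \<open>
  The neighbourhood condition says that where the growth rate \<open>\<nu>\<close> at \<open>P\<close> is negative, at least half of
  it is left at \<open>S\<close>; the acceleration term, of size at most \<open>h \<le> |\<nu>| / 4\<close>, then leaves a rate below
  \<open>\<nu> / 4\<close>.  The error consists of the first order effect of the acceleration and of the variance of
  the step.
\<close>

lemma lyapunov_step_le:
  fixes S P :: "real^'c^'v" and \<Omega> :: "real^'v^'v"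
  defines "G \<equiv> replicator S (\<Omega> ** S)"
  assumes nonneg: "\<And>x y. 0 \<le> \<Omega> $ x $ y" and rows: "\<And>x. (\<Sum>y\<in>UNIV. \<Omega> $ x $ y) = 1"
    and sym: "transpose \<Omega> = \<Omega>"
    and S: "S \<in> row_simplex" and pos: "\<And>x j. 0 < S $ x $ j" and P: "P \<in> row_simplex"
    and le: "S \<bullet> (\<Omega> ** S) \<le> P \<bullet> (\<Omega> ** P)"
    and \<theta>: "0 \<le> \<theta>" "\<theta> \<le> T" and h: "0 \<le> h" "h \<le> 1"
    and near: "\<And>x j. centred P (\<Omega> ** P) $ x $ j < 0 \<Longrightarrow>
      centred S (\<Omega> ** S) $ x $ j \<le> centred P (\<Omega> ** P) $ x $ j / 2 \<and> h \<le> - centred P (\<Omega> ** P) $ x $ j / 4"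
  shows "lyapunov \<Omega> T P (lift_exp_rows S (\<theta> *\<^sub>R (\<Omega> ** S + (h / 2) *\<^sub>R (\<Omega> ** G))))
    \<le> lyapunov \<Omega> T P S + (T * (real CARD('v) * real CARD('c)) / 2 * h
        + exp (2 * T) * (2 * T\<^sup>2 * (metric_norm_sq S G + real CARD('v) * h)))"
proof -
  define W where "W = \<theta> *\<^sub>R (\<Omega> ** S + (h / 2) *\<^sub>R (\<Omega> ** G))"
  define S' where "S' = lift_exp_rows S W"
  define \<mu> where "\<mu> = centred S (\<Omega> ** S)"
  define \<nu> where "\<nu> = centred P (\<Omega> ** P)"
  define \<eta> where "\<eta> = centred S (\<Omega> ** G)"
  have centred_le: "\<bar>centred Q M $ x $ j\<bar> \<le> 2" if "Q \<in> row_simplex" "\<And>x j. \<bar>M $ x $ j\<bar> \<le> 1" for Q M :: "real^'c^'v" and x j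
    using row_mean_abs_le[of Q M x 1] that(2)[of x j] that
    unfolding centred_nth by (smt (verit))
  \<comment> \<open>Entries of \<open>\<Omega> Q\<close> and their means lie in the unit interval, which improves the bound to \<open>1\<close>.\<close>
  have prob_centred: "\<bar>centred Q (\<Omega> ** Q) $ x $ j\<bar> \<le> 1" if Q: "Q \<in> row_simplex" for Q :: "real^'c^'v" and x j
  proof -
    have 0: "0 \<le> (\<Omega> ** Q) $ x $ j" for x j
      unfolding matrix_matrix_mult_nth by (intro sum_nonneg mult_nonneg_nonneg nonneg row_simplexD(1)[OF Q])
    have 1: "\<bar>(\<Omega> ** Q) $ x $ j\<bar> \<le> 1" for x j
      using row_simplexD[OF Q] by (intro stochastic_mult_abs_le nonneg rows) auto
    have "0 \<le> (\<Sum>i\<in>UNIV. Q $ x $ i * (\<Omega> ** Q) $ x $ i)"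
      by (intro sum_nonneg mult_nonneg_nonneg 0 row_simplexD(1)[OF Q])
    with 0 1 row_mean_abs_le[of Q "\<Omega> ** Q" x 1] Q show ?thesis
      unfolding centred_nth by (smt (verit))
  qed
  have \<mu>1: "\<bar>\<mu> $ x $ j\<bar> \<le> 1" and \<nu>1: "\<bar>\<nu> $ x $ j\<bar> \<le> 1" for x j
    using prob_centred S P by (auto simp: \<mu>_def \<nu>_def)
  have "\<bar>G $ x $ j\<bar> \<le> 1" for x j
    using mult_mono[of "S $ x $ j" 1 "\<bar>\<mu> $ x $ j\<bar>" 1] \<mu>1 row_simplexD[OF S]
    by (simp add: G_def replicator_nth abs_mult \<mu>_def)
  then have \<Omega>G: "\<bar>(\<Omega> ** G) $ x $ j\<bar> \<le> 1" for x j
    by (intro stochastic_mult_abs_le nonneg rows)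
  have \<eta>2: "\<bar>\<eta> $ x $ j\<bar> \<le> 2" for x j
    unfolding \<eta>_def using S \<Omega>G by (rule centred_le)
  \<comment> \<open>Deviations of the step from its row mean: the growth rates plus a perturbation of size \<open>h\<close>.\<close>
  have u: "centred S W $ x $ j = \<theta> * (\<mu> $ x $ j + h / 2 * \<eta> $ x $ j)" for x j
    unfolding W_def \<mu>_def \<eta>_def centred_nth
    by (simp add: algebra_simps sum.distrib sum_distrib_left)
  have h\<eta>: "\<bar>h / 2 * \<eta> $ x $ j\<bar> \<le> h" for x j
    using mult_left_mono[OF \<eta>2[of x j], of "h / 2"] h by (simp add: abs_mult)
  have u_bound: "\<bar>centred S W $ x $ j\<bar> \<le> 2 * T" for x j
  proof -
    have "\<bar>\<mu> $ x $ j + h / 2 * \<eta> $ x $ j\<bar> \<le> 2"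
      using \<mu>1[of x j] h\<eta>[of x j] h by linarith
    then have "\<theta> * \<bar>\<mu> $ x $ j + h / 2 * \<eta> $ x $ j\<bar> \<le> T * 2"
      using \<theta> by (intro mult_mono) auto
    then show ?thesis using \<theta> by (simp add: u abs_mult)
  qed
  have u_sq: "(centred S W $ x $ j)\<^sup>2 \<le> 2 * T\<^sup>2 * ((\<mu> $ x $ j)\<^sup>2 + h)" for x j
  proof -
    have "(h / 2 * \<eta> $ x $ j)\<^sup>2 \<le> h"
    proof -
      have "(h / 2 * \<eta> $ x $ j)\<^sup>2 \<le> h\<^sup>2"
        using h\<eta>[of x j] h by (simp add: abs_le_square_iff[symmetric])
      also have "\<dots> \<le> h"
        using h mult_right_mono[of h 1 h] by (simp add: power2_eq_square)
      finally show ?thesis .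
    qed
    moreover have "(a + b)\<^sup>2 \<le> 2 * (a\<^sup>2 + b\<^sup>2)" for a b :: real
      using zero_le_power2[of "a - b"] by (simp add: power2_sum power2_diff)
    ultimately have "(\<mu> $ x $ j + h / 2 * \<eta> $ x $ j)\<^sup>2 \<le> 2 * ((\<mu> $ x $ j)\<^sup>2 + h)"
      by (smt (verit))
    then have "\<theta>\<^sup>2 * (\<mu> $ x $ j + h / 2 * \<eta> $ x $ j)\<^sup>2 \<le> T\<^sup>2 * (2 * ((\<mu> $ x $ j)\<^sup>2 + h))"
      using \<theta> by (intro mult_mono power_mono) auto
    then show ?thesis by (simp only: u power_mult_distrib mult_ac)
  qed
  have g: "metric_norm_sq S G = (\<Sum>x\<in>UNIV. \<Sum>j\<in>UNIV. S $ x $ j * (\<mu> $ x $ j)\<^sup>2)"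
    unfolding G_def \<mu>_def by (rule metric_norm_sq_replicator[OF pos])
  have var: "(\<Sum>x\<in>UNIV. \<Sum>j\<in>UNIV. S $ x $ j * (centred S W $ x $ j)\<^sup>2)
      \<le> 2 * T\<^sup>2 * (metric_norm_sq S G + real CARD('v) * h)"
  proof -
    have "(\<Sum>x\<in>UNIV. \<Sum>j\<in>UNIV. S $ x $ j * (centred S W $ x $ j)\<^sup>2)
        \<le> (\<Sum>x\<in>UNIV. \<Sum>j\<in>UNIV. S $ x $ j * (2 * T\<^sup>2 * ((\<mu> $ x $ j)\<^sup>2 + h)))"
      by (intro sum_mono mult_left_mono u_sq row_simplexD(1)[OF S])
    also have "\<dots> = 2 * T\<^sup>2 * (\<Sum>x\<in>UNIV. (\<Sum>j\<in>UNIV. S $ x $ j * (\<mu> $ x $ j)\<^sup>2) + (\<Sum>j\<in>UNIV. S $ x $ j) * h)"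
      by (simp add: sum_distrib_left sum_distrib_right sum.distrib algebra_simps)
    also have "\<dots> = 2 * T\<^sup>2 * (metric_norm_sq S G + real CARD('v) * h)"
      by (simp add: row_simplexD(2)[OF S] g sum.distrib)
    finally show ?thesis .
  qed
  have SP1: "\<bar>(S - P) $ x $ j\<bar> \<le> 1" for x j
    using row_simplexD(1,3)[OF S, of x j] row_simplexD(1,3)[OF P, of x j] by (simp add: abs_le_iff)
  have "(S - P) \<bullet> (\<Omega> ** S) \<le> - (\<Sum>x\<in>UNIV. \<Sum>j\<in>UNIV. S $ x $ j * \<nu> $ x $ j)"
    unfolding \<nu>_def by (rule inner_gap_le_growth[OF sym S le])
  \<comment> \<open>Entries with positive growth rate contribute with the favourable sign and are dropped.\<close>
  also have "\<dots> \<le> (\<Sum>x\<in>UNIV. \<Sum>j\<in>UNIV. if \<nu> $ x $ j < 0 then - S $ x $ j * \<nu> $ x $ j else 0)"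
    unfolding sum_negf[symmetric] using row_simplexD(1)[OF S] by (intro sum_mono) auto
  finally have "\<theta> * ((S - P) \<bullet> (\<Omega> ** S))
      \<le> \<theta> * (\<Sum>x\<in>UNIV. \<Sum>j\<in>UNIV. if \<nu> $ x $ j < 0 then - S $ x $ j * \<nu> $ x $ j else 0)"
    using \<theta>(1) by (rule mult_left_mono)
  \<comment> \<open>The remaining entries decay, and the decrease of their weighted sum pays for this growth.\<close>
  also have "\<dots> \<le> (\<Sum>x\<in>UNIV. \<Sum>j\<in>UNIV. if \<nu> $ x $ j < 0 then 4 * (1 + T) * (S $ x $ j - S' $ x $ j) else 0)"
    unfolding sum_distrib_left
  proof (intro sum_mono)
    fix x :: 'v and j :: 'c
    show "\<theta> * (if \<nu> $ x $ j < 0 then - S $ x $ j * \<nu> $ x $ j else 0)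
        \<le> (if \<nu> $ x $ j < 0 then 4 * (1 + T) * (S $ x $ j - S' $ x $ j) else 0)"
    proof (cases "\<nu> $ x $ j < 0")
      case True
      define t where "t = - \<theta> * \<nu> $ x $ j / 4"
      have "\<theta> * (- \<nu> $ x $ j / 4) \<le> T * 1"
        using \<theta> \<nu>1[of x j] True by (intro mult_mono) auto
      then have t: "0 \<le> t" "t \<le> T"
        using \<theta> True by (auto simp: t_def mult_nonneg_nonpos)
      have "\<mu> $ x $ j + h / 2 * \<eta> $ x $ j \<le> \<nu> $ x $ j / 4"
        using near[of x j] True h\<eta>[of x j] unfolding \<mu>_def \<nu>_def by linarith
      then have "centred S W $ x $ j \<le> - t"
        using mult_left_mono[OF _ \<theta>(1), of _ "\<nu> $ x $ j / 4"] by (simp add: u t_def)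
      then have "S $ x $ j * exp (centred S W $ x $ j) \<le> S $ x $ j * exp (- t)"
        using row_simplexD(1)[OF S] by (intro mult_left_mono) auto
      then have "S' $ x $ j \<le> S $ x $ j * exp (- t)"
        using lift_exp_rows_component_le[OF S, of W x j] unfolding S'_def by linarith
      then have "S $ x $ j * (1 - exp (- t)) \<le> S $ x $ j - S' $ x $ j"
        by (simp add: right_diff_distrib)
      then have "4 * (1 + T) * (S $ x $ j * (1 - exp (- t))) \<le> 4 * (1 + T) * (S $ x $ j - S' $ x $ j)"
        using \<theta> by (intro mult_left_mono) auto
      moreover have "S $ x $ j * t \<le> S $ x $ j * ((1 + T) * (1 - exp (- t)))"
        by (intro mult_left_mono exp_minus_le t row_simplexD(1)[OF S])
      then have "4 * (S $ x $ j * t) \<le> 4 * (1 + T) * (S $ x $ j * (1 - exp (- t)))"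
        by (simp only: mult_ac)
      moreover have "\<theta> * (- S $ x $ j * \<nu> $ x $ j) = 4 * (S $ x $ j * t)"
        by (simp add: t_def)
      ultimately show ?thesis
        using True by simp
    qed simp
  qed
  also have "\<dots> = 4 * (1 + T) * (\<Sum>x\<in>UNIV. \<Sum>j\<in>UNIV. if \<nu> $ x $ j < 0 then S $ x $ j else 0)
      - 4 * (1 + T) * (\<Sum>x\<in>UNIV. \<Sum>j\<in>UNIV. if \<nu> $ x $ j < 0 then S' $ x $ j else 0)"
    unfolding sum_distrib_left sum_subtractf[symmetric]
    by (intro sum.cong refl) (auto simp: right_diff_distrib)
  finally have main: "\<theta> * ((S - P) \<bullet> (\<Omega> ** S)) \<le> \<dots>" .
  have "\<theta> * (h / 2 * ((S - P) \<bullet> (\<Omega> ** G))) \<le> T * (real CARD('v) * real CARD('c)) / 2 * h"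
  proof -
    have "\<bar>(S - P) \<bullet> (\<Omega> ** G)\<bar> \<le> real CARD('v) * real CARD('c)"
      using abs_inner_le_entries[OF SP1 \<Omega>G] by simp
    then have "h / 2 * ((S - P) \<bullet> (\<Omega> ** G)) \<le> h / 2 * (real CARD('v) * real CARD('c))"
      using h by (intro mult_left_mono) auto
    then have "\<theta> * (h / 2 * ((S - P) \<bullet> (\<Omega> ** G))) \<le> \<theta> * (h / 2 * (real CARD('v) * real CARD('c)))"
      using \<theta>(1) by (rule mult_left_mono)
    also have "\<dots> \<le> T * (h / 2 * (real CARD('v) * real CARD('c)))"
      using \<theta> h by (intro mult_right_mono) auto
    also have "\<dots> = T * (real CARD('v) * real CARD('c)) / 2 * h"
      by (simp add: mult_ac)
    finally show ?thesis .
  qed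
  moreover have "KL_divergence P S' - KL_divergence P S
      \<le> (S - P) \<bullet> W + exp (2 * T) * (\<Sum>x\<in>UNIV. \<Sum>j\<in>UNIV. S $ x $ j * (centred S W $ x $ j)\<^sup>2)"
    unfolding S'_def by (rule KL_divergence_step_le[OF S pos P u_bound])
  moreover have "exp (2 * T) * (\<Sum>x\<in>UNIV. \<Sum>j\<in>UNIV. S $ x $ j * (centred S W $ x $ j)\<^sup>2)
      \<le> exp (2 * T) * (2 * T\<^sup>2 * (metric_norm_sq S G + real CARD('v) * h))"
    using var by simp
  moreover have "(S - P) \<bullet> W = \<theta> * ((S - P) \<bullet> (\<Omega> ** S)) + \<theta> * (h / 2 * ((S - P) \<bullet> (\<Omega> ** G)))"
    unfolding W_def by (simp add: inner_add_right distrib_left)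
  ultimately show ?thesis
    using main unfolding lyapunov_def W_def[symmetric] S'_def[symmetric] \<nu>_def[symmetric]
    by linarith
qed

section \<open>Convergence of the algorithm\<close>

text \<open>
  Compactness provides a limit point \<open>P\<close>.  The step sizes eventually lie between \<open>\<theta>lim / 2\<close> and
  \<open>2 \<theta>lim\<close>: the lower bound turns the decrease of \<open>J\<close> into summability of the squared gradient norms,
  the upper bound \<open>T\<close> fixes the weight in the Lyapunov function.
\<close>

lemma accelerated_DC_run_converges:
  fixes \<Omega> :: "real^'v^'v" and DX :: "real^'c^'v"
  assumes nonneg: "\<And>x y. 0 \<le> \<Omega> $ x $ y" and rows: "\<And>x. (\<Sum>y\<in>UNIV. \<Omega> $ x $ y) = 1"
    and sym: "transpose \<Omega> = \<Omega>"
    and run: "accelerated_DC_run \<Omega> DX c1 c2 \<gamma> S \<theta> h"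
    and lim: "\<theta> \<longlonglongrightarrow> \<theta>lim" "0 < \<theta>lim" and h: "summable h"
  obtains P where "S \<longlonglongrightarrow> P" "(\<lambda>k. KL_divergence P (S k)) \<longlonglongrightarrow> 0" "equilibrium \<Omega> P"
proof -
  define g where "g k = metric_norm_sq (S k) (replicator (S k) (\<Omega> ** S k))" for k
  define J where "J k = objective \<Omega> (S k)" for k
  have c1: "0 < c1" and S0: "S 0 = lift_exp_rows barycenter (- (\<Omega> ** DX))"
    and adm: "admissible_h \<Omega> (S k) (h k)"
    and ls: "line_search_conditions \<Omega> c1 c2 (S k) (descent_direction \<Omega> (S k) (h k)) (\<theta> k)"
    and SSuc: "S (Suc k) = lift_exp_rows (S k) (\<theta> k *\<^sub>R descent_direction \<Omega> (S k) (h k))" for k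
    using run unfolding accelerated_DC_run_def Let_def by (auto split: if_splits) metis
  have pos: "0 < S k $ x $ j" for k x j
  proof (induction k arbitrary: x j)
    case 0
    then show ?case unfolding S0 by (intro lift_exp_rows_interior) (simp add: barycenter_def)
  next
    case (Suc k)
    then show ?case unfolding SSuc by (intro lift_exp_rows_interior)
  qed
  have simplex: "S k \<in> row_simplex" for k
  proof (cases k)
    case 0
    then show ?thesis using S0 by (auto intro!: lift_exp_rows_interior simp: barycenter_def)
  next
    case (Suc k)
    then show ?thesis using SSuc by (auto intro!: lift_exp_rows_interior pos)
  qed
  have h0: "0 \<le> h k" for k
    by (rule admissible_h_nonneg[OF adm])
  have g0: "0 \<le> g k" for k
    unfolding g_def by (rule metric_norm_sq_nonneg[OF pos])
  have "\<forall>\<^sub>F k in sequentially. \<theta> k > \<theta>lim / 2 \<and> \<theta> k < 2 * \<theta>lim"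
    using lim by (intro eventually_conj order_tendstoD[OF lim(1)]) auto
  then obtain k1 where k1: "\<And>k. k1 \<le> k \<Longrightarrow> \<theta>lim / 2 \<le> \<theta> k \<and> \<theta> k \<le> 2 * \<theta>lim"
    unfolding eventually_sequentially by (meson less_imp_le)
  define \<beta> where "\<beta> = c1 * \<theta>lim / 4"
  have \<beta>: "0 < \<beta>" using c1 lim by (simp add: \<beta>_def)
  have decrease: "\<beta> * g k \<le> J k - J (Suc k)" if "k1 \<le> k" for k
  proof -
    have "J (Suc k) \<le> J k - c1 * \<theta> k / 2 * g k"
      unfolding J_def g_def SSuc using k1[OF that] lim c1
      by (intro objective_decrease[OF simplex pos adm _ _ ls]) auto
    moreover have "\<beta> * g k \<le> c1 * \<theta> k / 2 * g k"
      using k1[OF that] c1 unfolding \<beta>_def by (intro mult_right_mono g0) simp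
    ultimately show ?thesis by simp
  qed
  obtain P r where P: "P \<in> row_simplex" and r: "strict_mono r" "(\<lambda>l. S (r l)) \<longlonglongrightarrow> P"
    using simplex compact_imp_seq_compact[OF compact_row_simplex]
    by (auto simp: o_def elim!: seq_compactE[of _ S])
  have Jlim: "(\<lambda>l. J (r l)) \<longlonglongrightarrow> objective \<Omega> P"
    unfolding J_def objective_def by (intro tendsto_intros tendsto_matrix_mult r(2))
  have J_mono: "J n \<le> J m" if "k1 \<le> m" "m \<le> n" for m n
    using that(2)
  proof (induction n rule: dec_induct)
    case (step n)
    then show ?case
      using decrease[of n] that(1) mult_nonneg_nonneg[OF less_imp_le[OF \<beta>] g0[of n]] by linarith
  qed simp
  have J_ge: "objective \<Omega> P \<le> J k" if "k1 \<le> k" for k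
  proof (rule LIMSEQ_le_const2[OF Jlim])
    have "J (r l) \<le> J k" if "k \<le> l" for l
      using J_mono[OF \<open>k1 \<le> k\<close>] seq_suble[OF r(1), of l] that by simp
    then show "\<exists>N. \<forall>l\<ge>N. J (r l) \<le> J k" by blast
  qed
  \<comment> \<open>The decrease of \<open>J\<close> telescopes, and \<open>J\<close> is bounded below by its value at the limit point.\<close>
  have "summable (\<lambda>i. g (i + k1))"
  proof (rule summableI_nonneg_bounded)
    fix n
    have "\<beta> * (\<Sum>i<n. g (i + k1)) \<le> J k1 - J (n + k1)"
    proof (induction n)
      case (Suc n)
      then show ?case using decrease[of "n + k1"] by (simp add: distrib_left)
    qed simp
    then show "(\<Sum>i<n. g (i + k1)) \<le> (J k1 - objective \<Omega> P) / \<beta>"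
      using J_ge[of "n + k1"] \<beta> by (simp add: field_simps)
  qed (rule g0)
  then have g: "summable g" by (simp add: summable_iff_shift)
  have equil: "replicator P (\<Omega> ** P) = 0"
  proof -
    have g_lim: "(\<lambda>l. g (r l)) \<longlonglongrightarrow> 0"
      using LIMSEQ_subseq_LIMSEQ[OF summable_LIMSEQ_zero[OF g] r(1)] by (simp add: o_def)
    have "(norm (replicator (S k) (\<Omega> ** S k)))\<^sup>2 \<le> g k" for k
      unfolding g_def by (rule norm_replicator_le[OF pos simplex])
    then have "(\<lambda>l. (norm (replicator (S (r l)) (\<Omega> ** S (r l))))\<^sup>2) \<longlonglongrightarrow> 0"
      by (intro Lim_null_comparison[OF _ g_lim] always_eventually) simp
    moreover have "(\<lambda>l. (norm (replicator (S (r l)) (\<Omega> ** S (r l))))\<^sup>2)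
        \<longlonglongrightarrow> (norm (replicator P (\<Omega> ** P)))\<^sup>2"
      by (intro tendsto_intros tendsto_replicator tendsto_matrix_mult r(2))
    ultimately show ?thesis
      using LIMSEQ_unique by fastforce
  qed
  define T where "T = 2 * \<theta>lim"
  define \<nu> where "\<nu> = centred P (\<Omega> ** P)"
  define e where "e k = T * (real CARD('v) * real CARD('c)) / 2 * h k
      + exp (2 * T) * (2 * T\<^sup>2 * (g k + real CARD('v) * h k))" for k
  have h_lim: "h \<longlonglongrightarrow> 0" by (rule summable_LIMSEQ_zero[OF h])
  have "\<forall>\<^sub>F k in sequentially. h k < 1 \<and> (\<forall>x j. \<nu> $ x $ j < 0 \<longrightarrow> h k < - \<nu> $ x $ j / 4)"
  proof (intro eventually_conj eventually_all_finite)
    show "\<forall>\<^sub>F k in sequentially. h k < 1"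
      by (rule order_tendstoD(2)[OF h_lim]) simp
    show "\<forall>\<^sub>F k in sequentially. \<nu> $ x $ j < 0 \<longrightarrow> h k < - \<nu> $ x $ j / 4" for x j
      using order_tendstoD(2)[OF h_lim, of "- \<nu> $ x $ j / 4"] by (cases "\<nu> $ x $ j < 0") auto
  qed
  then obtain k2 where k2: "\<And>k. k2 \<le> k \<Longrightarrow> h k < 1 \<and> (\<forall>x j. \<nu> $ x $ j < 0 \<longrightarrow> h k < - \<nu> $ x $ j / 4)"
    unfolding eventually_sequentially by blast
  have "\<forall>\<^sub>F Q in nhds P. \<forall>x j. \<nu> $ x $ j < 0 \<longrightarrow> centred Q (\<Omega> ** Q) $ x $ j < \<nu> $ x $ j / 2"
  proof (intro eventually_all_finite)
    fix x j
    have "((\<lambda>Q. centred Q (\<Omega> ** Q) $ x $ j) \<longlongrightarrow> \<nu> $ x $ j) (nhds P)"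
      unfolding \<nu>_def by (intro tendsto_centred tendsto_matrix_mult filterlim_ident)
    then show "\<forall>\<^sub>F Q in nhds P. \<nu> $ x $ j < 0 \<longrightarrow> centred Q (\<Omega> ** Q) $ x $ j < \<nu> $ x $ j / 2"
      by (cases "\<nu> $ x $ j < 0") (auto dest!: order_tendstoD(2)[where a = "\<nu> $ x $ j / 2"])
  qed
  then obtain \<delta> where \<delta>: "0 < \<delta>" "\<And>Q. dist Q P < \<delta> \<Longrightarrow> 
      \<forall>x j. \<nu> $ x $ j < 0 \<longrightarrow> centred Q (\<Omega> ** Q) $ x $ j < \<nu> $ x $ j / 2"
    unfolding eventually_nhds_metric by blast
  have T: "0 < T" using lim by (simp add: T_def)
  have "S \<longlonglongrightarrow> P"
  proof (rule local_quasi_Fejer_convergence[where s = S and p = P and e = e and C = 4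
        and ?k0.0 = "max k1 k2" and L = "\<lambda>k. lyapunov \<Omega> T P (S k)"])
    fix k assume k: "max k1 k2 \<le> k" "dist (S k) P < \<delta>"
    have "S k \<bullet> (\<Omega> ** S k) \<le> P \<bullet> (\<Omega> ** P)"
      using J_ge[of k] k by (simp add: J_def objective_def)
    moreover have "0 \<le> \<theta> k" "\<theta> k \<le> T" "h k \<le> 1"
      using k1[of k] k2[of k] k(1) lim(2) by (auto simp: T_def)
    moreover have "centred (S k) (\<Omega> ** S k) $ x $ j \<le> centred P (\<Omega> ** P) $ x $ j / 2 \<and>
        h k \<le> - centred P (\<Omega> ** P) $ x $ j / 4" if "centred P (\<Omega> ** P) $ x $ j < 0" for x j
      using k2[of k] \<delta>(2)[OF k(2)] k(1) that unfolding \<nu>_def by (meson less_imp_le max.boundedE)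
    ultimately show "lyapunov \<Omega> T P (S (Suc k)) \<le> lyapunov \<Omega> T P (S k) + e k"
      unfolding SSuc lift_exp_rows_descent_direction e_def g_def
      using lyapunov_step_le[OF nonneg rows sym simplex[of k] pos P _ _ _ h0[of k]] by blast
  next
    fix k
    have "0 \<le> (\<Sum>x\<in>UNIV. \<Sum>j\<in>UNIV. if \<nu> $ x $ j < 0 then S k $ x $ j else 0)"
      using less_imp_le[OF pos] by (intro sum_nonneg) auto
    then have "KL_divergence P (S k) \<le> lyapunov \<Omega> T P (S k)"
      using T by (simp add: lyapunov_def \<nu>_def)
    then show "(dist (S k) P)\<^sup>2 \<le> 4 * lyapunov \<Omega> T P (S k)"
      using norm_sq_le_KL_divergence[OF P simplex pos, of k] by (simp add: dist_norm)
  next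
    show "0 \<le> e k" for k using T h0[of k] g0[of k] by (simp add: e_def)
    show "summable e"
      unfolding e_def by (intro summable_add summable_mult h g)
    \<comment> \<open>Equilibrium means \<open>P \<nu> = 0\<close> entrywise, so the entries in the second summand tend to zero.\<close>
    have "P $ x $ j = 0" if "\<nu> $ x $ j < 0" for x j
      using that arg_cong[OF equil, of "\<lambda>U. U $ x $ j"] by (simp add: replicator_nth \<nu>_def)
    then have "(\<lambda>l. if \<nu> $ x $ j < 0 then S (r l) $ x $ j else 0) \<longlonglongrightarrow> 0" for x j
      using tendsto_vec_nth[OF tendsto_vec_nth[OF r(2)], of x j] by (cases "\<nu> $ x $ j < 0") auto
    then have "(\<lambda>l. \<Sum>x\<in>UNIV. \<Sum>j\<in>UNIV. if \<nu> $ x $ j < 0 then S (r l) $ x $ j else 0) \<longlonglongrightarrow> 0"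
      by (intro tendsto_null_sum)
    then show "(\<lambda>l. lyapunov \<Omega> T P (S (r l))) \<longlonglongrightarrow> 0"
      unfolding lyapunov_def \<nu>_def[symmetric]
      by (intro tendsto_add_zero tendsto_mult_right_zero KL_divergence_tendsto_0 r(2))
  qed (simp_all add: \<delta>(1) r(1))
  moreover have "P \<in> closure assignment_manifold"
    unfolding closure_sequential
    using \<open>S \<longlonglongrightarrow> P\<close> interior_in_assignment_manifold[OF simplex pos] by blast
  ultimately show ?thesis
    using equil that KL_divergence_tendsto_0[OF \<open>S \<longlonglongrightarrow> P\<close>] by (simp add: equilibrium_def)
qed

theorem theorem6p4:
  fixes V :: "(int^'d) set"
    and vert :: "'v::finite \<Rightarrow> int^'d"
    and \<alpha> \<Theta> :: "int^'d \<Rightarrow> int^'d \<Rightarrow> real"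
    and \<Omega> :: "real^'v^'v"
    and DX :: "real^'c^'v"
    and S :: "nat \<Rightarrow> real^'c^'v"
    and \<theta> h :: "nat \<Rightarrow> real"
    and c1 c2 \<gamma> \<theta>min \<theta>max :: real
    and K :: nat
  assumes "CARD('d) \<ge> 2"
    and "CARD('c) \<ge> 2"
    and "bij_betw vert UNIV V"
    and "nonlocal_kernels V \<alpha> \<Theta>"
    and "\<Omega> = weight_matrix vert \<alpha> \<Theta>"
    and "\<forall>x y. 0 \<le> \<Omega> $ x $ y \<and> \<Omega> $ x $ y \<le> 1"
    and "\<forall>x. (\<Sum>y\<in>UNIV. \<Omega> $ x $ y) = 1"
    and "accelerated_DC_run \<Omega> DX c1 c2 \<gamma> S \<theta> h"
    and "\<forall>k. \<theta> k \<in> {\<theta>min .. \<theta>max}"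
    and "\<exists>\<theta>lim>0. \<theta> \<longlonglongrightarrow> \<theta>lim"
    and "summable h"
    and "\<forall>k\<ge>K. h k \<le> (2 * (\<theta>min * c1) / (lambda_abs \<Omega>)\<^sup>2)
                        * (metric_norm_sq (S k) (grad_objective \<Omega> (S k)) / real CARD('v))"
  shows "\<exists>Sstar \<in> closure assignment_manifold.
           limit_points S = {Sstar} \<and>
           (\<lambda>k. KL_divergence Sstar (S k)) \<longlonglongrightarrow> 0 \<and>
           S \<longlonglongrightarrow> Sstar \<and>
           equilibrium \<Omega> Sstar"
proof -
  have "transpose \<Omega> = \<Omega>"
    using weight_matrix_symmetric[of V \<alpha> \<Theta> vert] assms(3,4,5) by (auto simp: bij_betw_def)
  moreover obtain \<theta>lim where "\<theta> \<longlonglongrightarrow> \<theta>lim" "0 < \<theta>lim" using assms(10) by blast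
  ultimately obtain P where P: "S \<longlonglongrightarrow> P" "(\<lambda>k. KL_divergence P (S k)) \<longlonglongrightarrow> 0" "equilibrium \<Omega> P"
    using accelerated_DC_run_converges[of \<Omega> DX c1 c2 \<gamma> S \<theta> h] assms(6,7,8,11) by metis
  have closure: "P \<in> closure assignment_manifold"
    using P(3) by (simp add: equilibrium_def)
  have "limit_points S = {P}"
  proof (intro equalityI subsetI)
    fix Q assume "Q \<in> limit_points S"
    then obtain r where "strict_mono r" "(\<lambda>l. S (r l)) \<longlonglongrightarrow> Q"
      by (auto simp: limit_points_def)
    then show "Q \<in> {P}"
      using LIMSEQ_subseq_LIMSEQ[OF P(1)] LIMSEQ_unique by (fastforce simp: o_def)
  next
    fix Q assume "Q \<in> {P}"
    then show "Q \<in> limit_points S"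
      using P(1) closure strict_mono_id by (auto simp: limit_points_def id_def)
  qed
  then show ?thesis using closure P by blast
qed

end
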